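(* Let $p\ge 2$ and let $\mathcal{S}=\{S_1,S_2,\ldots,S_p\}$ with $S_i\subseteq\mathbb{N}$ nonempty for $1\le i\le p$. Let $X(\mathcal{S})$ be the $\mathcal{S}$-limited shift and $G_{\mathcal{S}}$ its core set. Then the topological entropy of $X(\mathcal{S})$ is $\log\frac{1}{\lambda}$, where $\lambda$ is the unique positive solution to $$\sum_{\omega\in G_{\mathcal{S}}}x^{|\omega|}=1 .$$
   Context: $\mathbb{N}=\{1,2,3,\ldots\}$. The alphabet is $\mathcal{A}=\{1,\ldots,p\}$, and $\mathcal{S}=\{S_1,\ldots,S_p\}$ is an indexed family (repetitions $S_i=S_j$ are allowed). The core set is the set of finite words $G_{\mathcal{S}}=\{1^{m_1}2^{m_2}\cdots p^{m_p} : m_i\in S_i \text{ for } 1\le i\le p\}$, where $a^m$ is the letter $a$ repeated $m$ times. The $\mathcal{S}$-limited shift is the subshift $X(\mathcal{S})\subseteq\mathcal{A}^{\mathbb{Z}}$ given by the closure (in the product topology) of the set of all bi-infinite concatenations $\cdots x_{-1}x_0x_1\cdots$ with $x_i\in G_{\mathcal{S}}$ for all $i\in\mathbb{Z}$ (with the origin placed at any coordinate, so the set is shift-invariant). $|\omega|$ denotes the length of the word $\omega$. The topological entropy of a subshift $X$ is $h(X)=\lim_{n\to\infty}\frac{1}{n}\log \#B_n(X)$, where $B_n(X)$ is the set of words of length $n$ occurring in points of $X$ and $\log$ is the natural logarithm. *)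

theory Defs
  imports "HOL-Analysis.Analysis"
begin

text \<open>Letters are natural numbers and the alphabet is \<open>{1..p}\<close>; bi-infinite sequences have
  type \<open>int \<Rightarrow> nat\<close>, words are lists. The family is indexed by \<open>{1..p}\<close>; values of
  \<open>S\<close> outside this range play no role.\<close>

definition core_set :: "nat \<Rightarrow> (nat \<Rightarrow> nat set) \<Rightarrow> nat list set" where
  "core_set p S =
     {concat (map (\<lambda>i. replicate (m i) i) [1..<Suc p]) | m. \<forall>i\<in>{1..p}. m i \<in> S i}"

text \<open>The word \<open>w i\<close> occupies the coordinates \<open>c i, \<dots>, c (i + 1) - 1\<close>. As \<open>c 0\<close> is
  unconstrained, the origin may lie anywhere. If all words in \<open>G\<close> are nonempty, then \<open>c\<close> is
  strictly increasing, so these blocks partition the integers.\<close>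

definition biinfinite_concatenations :: "'a list set \<Rightarrow> (int \<Rightarrow> 'a) set" where
  "biinfinite_concatenations G =
     {x. \<exists>(w :: int \<Rightarrow> 'a list) (c :: int \<Rightarrow> int).
           (\<forall>i. w i \<in> G) \<and>
           (\<forall>i. c (i + 1) = c i + int (length (w i))) \<and>
           (\<forall>i. \<forall>j < length (w i). x (c i + int j) = w i ! j)}"

text \<open>The closure is taken in the product topology on \<open>int \<Rightarrow> nat\<close>, with \<open>nat\<close> discrete. It agrees
  with the closure inside the full shift over \<open>{1..p}\<close>, which is a closed subset.\<close>

definition limited_shift :: "nat \<Rightarrow> (nat \<Rightarrow> nat set) \<Rightarrow> (int \<Rightarrow> nat) set" where
  "limited_shift p S = closure (biinfinite_concatenations (core_set p S))"

definition blocks :: "(int \<Rightarrow> 'a) set \<Rightarrow> nat \<Rightarrow> 'a list set" where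
  "blocks X n = {map (\<lambda>j. x (k + int j)) [0..<n] | x k. x \<in> X}"

definition block_growth :: "(int \<Rightarrow> 'a) set \<Rightarrow> nat \<Rightarrow> real" where
  "block_growth X n = ln (real (card (blocks X n))) / real n"

text \<open>\<open>lim\<close> is meaningful only if \<open>block_growth X\<close> converges, so statements about the
  entropy should also assert convergence.\<close>

definition topological_entropy :: "(int \<Rightarrow> 'a) set \<Rightarrow> real" where
  "topological_entropy X = lim (block_growth X)"

end

theory Submission
  imports Defs "HOL-Real_Asymp.Real_Asymp"
begin

text \<open>Core words are sorted and end with a letter larger than the first letter of any core word,
  so in a concatenation the word boundaries are exactly the descents. Hence the number \<open>t n\<close> of
  length-\<open>n\<close> prefixes of concatenations satisfies the renewal equation
  \<open>t n = e n + (\<Sum>w | length w < n. t (n - length w))\<close>, with \<open>e n\<close> the number of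
  length-\<open>n\<close> prefixes of single core words. There are at most \<open>(n + 1) ^ p\<close> sorted words of
  length \<open>n\<close>, and every core word of length at least \<open>n\<close> is such a prefix followed by a sorted
  word. If the weights \<open>l ^ length w\<close> sum to 1, the renewal equation therefore bounds
  \<open>t n * l ^ n\<close> above by a polynomial in \<open>n\<close> and below by a positive constant. A block of the
  shift is a sorted word followed by such a prefix, so block counts obey the same bounds.\<close>

section \<open>Counting sorted words\<close>

definition sorted_words :: "nat \<Rightarrow> nat list set" where
  "sorted_words p = {u. sorted u \<and> set u \<subseteq> {1..p}}"

text \<open>A sorted word is determined by its letter multiplicities: \<open>p\<close> numbers, each
  between 0 and \<open>n\<close>.\<close>

lemma
  fixes p n :: nat
  shows finite_sorted_words_length: "finite {u \<in> sorted_words p. length u = n}"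
    and card_sorted_words_length: "card {u \<in> sorted_words p. length u = n} \<le> (n + 1) ^ p"
proof -
  let ?W = "{u \<in> sorted_words p. length u = n}"
  let ?P = "{1..p} \<rightarrow>\<^sub>E {0..n}"
  define f where "f u = restrict (count_list u) {1..p}" for u :: "nat list"
  have inj: "inj_on f ?W"
  proof (rule inj_onI)
    fix u v assume u: "u \<in> ?W" and v: "v \<in> ?W" and eq: "f u = f v"
    have "count_list u i = count_list v i" for i
    proof (cases "i \<in> {1..p}")
      case True
      then show ?thesis using fun_cong[OF eq, of i] by (simp add: f_def)
    next
      case False
      then have "i \<notin> set u" "i \<notin> set v" using u v by (auto simp: sorted_words_def)
      then show ?thesis by simp
    qed
    then have "mset u = mset v" by (simp add: multiset_eq_iff count_mset)
    then show "u = v" using u v properties_for_sort[of u v] by (auto simp: sorted_words_def sorted_sort_id)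
  qed
  have sub: "f ` ?W \<subseteq> ?P"
    using count_le_length by (auto simp: f_def PiE_iff)
  have fin: "finite ?P" by (intro finite_PiE) auto
  show "finite ?W" using inj sub fin by (meson finite_imageD finite_subset)
  have "card ?W \<le> card ?P" using card_inj_on_le[OF inj sub fin] .
  then show "card ?W \<le> (n + 1) ^ p" by (simp add: card_PiE)
qed

lemma summable_poly_times_geometric:
  fixes x :: real
  assumes "0 < x" "x < 1"
  shows "summable (\<lambda>n. real ((n + 1) ^ p) * x ^ n)"
proof (rule summable_comparison_test_bigo)
  \<comment> \<open>Any ratio strictly between \<open>x\<close> and 1 absorbs the polynomial factor;
    the midpoint is one such ratio.\<close>
  show "summable (\<lambda>n. norm (((1 + x) / 2) ^ n))"
    using assms by (simp add: summable_geometric)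
  show "(\<lambda>n. real ((n + 1) ^ p) * x ^ n) \<in> O(\<lambda>n. ((1 + x) / 2) ^ n)"
    using assms by real_asymp
qed

text \<open>Grouping by length bounds every finite partial sum by the convergent series of
  polynomial times geometric terms. The finite total serves twice: as the constant of the lower
  growth bound and to dominate the power series of \<open>G\<close>.\<close>

lemma summable_on_sorted_words:
  fixes x :: real
  assumes "0 < x" "x < 1"
  shows "(\<lambda>u. x ^ length u) summable_on sorted_words p"
proof (rule nonneg_bdd_above_summable_on)
  let ?g = "\<lambda>n. real ((n + 1) ^ p) * x ^ n"
  show "bdd_above (sum (\<lambda>u. x ^ length u) ` {F. F \<subseteq> sorted_words p \<and> finite F})"
  proof (rule bdd_aboveI2)
    fix F assume F: "F \<in> {F. F \<subseteq> sorted_words p \<and> finite F}"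
    then have fin: "finite F" and sub: "F \<subseteq> sorted_words p" by auto
    have "(\<Sum>u\<in>F. x ^ length u) = (\<Sum>n\<in>length ` F. \<Sum>u\<in>{u \<in> F. length u = n}. x ^ length u)"
      by (rule sum.image_gen[OF fin])
    also have "\<dots> = (\<Sum>n\<in>length ` F. real (card {u \<in> F. length u = n}) * x ^ n)"
      by (intro sum.cong) auto
    also have "\<dots> \<le> (\<Sum>n\<in>length ` F. ?g n)"
    proof (intro sum_mono mult_right_mono of_nat_mono)
      fix n
      have "card {u \<in> F. length u = n} \<le> card {u \<in> sorted_words p. length u = n}"
        using sub by (intro card_mono finite_sorted_words_length) auto
      then show "card {u \<in> F. length u = n} \<le> (n + 1) ^ p"
        using card_sorted_words_length le_trans by blast
    qed (use assms in auto)
    also have "\<dots> \<le> suminf ?g"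
      using fin assms by (intro sum_le_suminf summable_poly_times_geometric) auto
    finally show "(\<Sum>u\<in>F. x ^ length u) \<le> suminf ?g" .
  qed
qed (use assms in auto)

section \<open>Blocks under closure and bi-infinite concatenations\<close>

text \<open>Finitely many coordinates with discrete values cut out an open cylinder, so each block
  of a limit point already occurs, at the same position, in a point of \<open>X\<close>.\<close>

lemma blocks_closure:
  fixes X :: "(int \<Rightarrow> 'a :: discrete_topology) set"
  shows "blocks (closure X) n = blocks X n"
proof
  show "blocks X n \<subseteq> blocks (closure X) n"
    using closure_subset by (fastforce simp: blocks_def)
  show "blocks (closure X) n \<subseteq> blocks X n"
  proof
    fix v assume "v \<in> blocks (closure X) n"
    then obtain x k where x: "x \<in> closure X" and v: "v = map (\<lambda>j. x (k + int j)) [0..<n]"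
      by (auto simp: blocks_def)
    define U where "U = (\<Inter>j<n. (\<lambda>y. y (k + int j)) -` {x (k + int j)})"
    have "open U" unfolding U_def
      by (intro open_INT finite_lessThan ballI open_vimage open_discrete continuous_on_product_coordinates)
    moreover have "x \<in> U" by (simp add: U_def)
    ultimately obtain y where "y \<in> X" "y \<in> U"
      using x by (meson disjoint_iff open_Int_closure_eq_empty)
    then have "v = map (\<lambda>j. y (k + int j)) [0..<n]" by (auto simp: v U_def)
    then show "v \<in> blocks X n" using \<open>y \<in> X\<close> by (auto simp: blocks_def)
  qed
qed

text \<open>A strictly increasing integer sequence is unbounded in both directions, so its intervals
  tile the integers. This locates the word covering a coordinate, both to build a point from words
  and to analyse a given one.\<close>

lemma ex_unique_block_index:
  fixes c :: "int \<Rightarrow> int"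
  assumes step: "\<And>i. c i < c (i + 1)"
  shows "\<exists>!i. c i \<le> k \<and> k < c (i + 1)"
proof -
  have "\<exists>i. c i \<le> k \<and> k < c (i + 1)"
  proof (induction k rule: int_induct[of _ "c 0"])
    case base
    then show ?case using step[of 0] by auto
  next
    case (step1 k)
    then obtain i where "c i \<le> k" "k < c (i + 1)" by blast
    then show ?case
      using step[of "i + 1"] by (intro exI[of _ "if k + 1 < c (i + 1) then i else i + 1"]) auto
  next
    case (step2 k)
    then obtain i where "c i \<le> k" "k < c (i + 1)" by blast
    then show ?case
      using step[of "i - 1"] by (intro exI[of _ "if c i \<le> k - 1 then i else i - 1"]) auto
  qed
  moreover have mono: "c i \<le> c j" if "i \<le> j" for i j
    using that by (induction j rule: int_ge_induct) (use step in \<open>auto intro: order_trans less_imp_le\<close>)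
  have "i = j" if "c i \<le> k" "k < c (i + 1)" "c j \<le> k" "k < c (j + 1)" for i j
    using that mono[of "i + 1" j] mono[of "j + 1" i] by linarith
  ultimately show ?thesis by blast
qed

text \<open>This turns finitely many consecutive words into a window of the point, linking list
  concatenation with the coordinate description by \<open>c\<close>.\<close>

lemma concat_eq_window:
  fixes w :: "int \<Rightarrow> 'a list" and c :: "int \<Rightarrow> int"
  assumes c: "\<And>i. c (i + 1) = c i + int (length (w i))"
    and x: "\<And>i j. j < length (w i) \<Longrightarrow> x (c i + int j) = w i ! j"
  defines "u \<equiv> \<lambda>i N. concat (map (\<lambda>j. w (i + int j)) [0..<N])"
  shows "u i N = map (\<lambda>j. x (c i + int j)) [0..<length (u i N)]
    \<and> c (i + int N) = c i + int (length (u i N))"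
proof (induction N)
  case 0
  then show ?case by (simp add: u_def)
next
  case (Suc N)
  let ?l = "length (u i N)"
  have u: "u i (Suc N) = u i N @ w (i + int N)" by (simp add: u_def)
  have "w (i + int N) = map (\<lambda>j. x (c i + int (?l + j))) [0..<length (w (i + int N))]"
    using Suc x[of _ "i + int N"] by (intro nth_equalityI) (auto simp: add.assoc)
  also have "\<dots> = map (\<lambda>j. x (c i + int j)) [?l..<?l + length (w (i + int N))]"
    by (intro nth_equalityI) auto
  finally have "u i (Suc N) = map (\<lambda>j. x (c i + int j)) [0..<?l + length (w (i + int N))]"
    using Suc unfolding u upt_add_eq_append[OF le0] map_append by argo
  moreover have "c (i + int (Suc N)) = c i + int (length (u i (Suc N)))"
    using Suc c[of "i + int N"] by (simp add: u add.assoc add.commute[of 1])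
  ultimately show ?case by (simp add: u)
qed

lemma ex_biinfinite_concatenation:
  fixes w :: "int \<Rightarrow> 'a list"
  assumes ne: "\<And>i. w i \<noteq> []"
  shows "\<exists>(x :: int \<Rightarrow> 'a) (c :: int \<Rightarrow> int). (\<forall>i. c (i + 1) = c i + int (length (w i))) \<and>
    (\<forall>i. \<forall>j < length (w i). x (c i + int j) = w i ! j)"
proof -
  \<comment> \<open>A signed partial sum with \<open>c 0 = 0\<close>: the second sum is empty for
    nonnegative \<open>i\<close>, the first for nonpositive \<open>i\<close>.\<close>
  define c where "c i = (\<Sum>j\<in>{0..<i}. int (length (w j))) - (\<Sum>j\<in>{i..<0}. int (length (w j)))" for i
  have c: "c (i + 1) = c i + int (length (w i))" for i
  proof (cases "i \<ge> 0")
    case True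
    then have "{0..<i + 1} = insert i {0..<i}" by auto
    then show ?thesis using True by (simp add: c_def)
  next
    case False
    then have "{i..<0} = insert i {i + 1..<0}" by auto
    then show ?thesis using False by (simp add: c_def)
  qed
  define idx where "idx k = (THE i. c i \<le> k \<and> k < c (i + 1))" for k
  define x where "x k = w (idx k) ! nat (k - c (idx k))" for k
  have "x (c i + int j) = w i ! j" if "j < length (w i)" for i j
  proof -
    have "\<exists>!i'. c i' \<le> c i + int j \<and> c i + int j < c (i' + 1)"
      using ne by (intro ex_unique_block_index) (simp add: c)
    then have "idx (c i + int j) = i"
      unfolding idx_def by (rule the1_equality) (use that in \<open>simp add: c\<close>)
    then show ?thesis by (simp add: x_def)
  qed
  then show ?thesis using c by blast
qed

section \<open>Prefixes of concatenations and the renewal equation\<close>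

text \<open>The length condition guarantees that \<open>take\<close> yields exactly \<open>n\<close>
  letters, so finite concatenations can stand for one-sided infinite ones.\<close>

definition concat_prefixes :: "'a list set \<Rightarrow> nat \<Rightarrow> 'a list set" where
  "concat_prefixes G n = {take n (concat ws) | ws. ws \<in> lists G \<and> n \<le> length (concat ws)}"

definition word_prefixes :: "'a list set \<Rightarrow> nat \<Rightarrow> 'a list set" where
  "word_prefixes G n = take n ` {w \<in> G. n \<le> length w}"

lemma concat_prefixes_0 [simp]: "concat_prefixes G 0 = {[]}"
  by (auto simp: concat_prefixes_def intro: exI[of _ "[]"])

lemma length_concat_prefixes: "v \<in> concat_prefixes G n \<Longrightarrow> length v = n"
  by (auto simp: concat_prefixes_def)

text \<open>These properties abstract from the core set what makes unique parsing work: no descent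
  inside a word, and by \<open>descent\<close> a strict one at every boundary.\<close>

locale descent_code =
  fixes p :: nat and G :: "nat list set"
  assumes sorted_words: "G \<subseteq> sorted_words p"
    and nonempty: "G \<noteq> {}"
    and words_nonempty: "w \<in> G \<Longrightarrow> w \<noteq> []"
    and descent: "w \<in> G \<Longrightarrow> w' \<in> G \<Longrightarrow> hd w' < last w"
begin

abbreviation "T \<equiv> concat_prefixes G"
abbreviation "E \<equiv> word_prefixes G"

lemma length_pos: "w \<in> G \<Longrightarrow> 0 < length w"
  using words_nonempty by blast

lemma finite_short: "finite {w \<in> G. length w < n}"
proof -
  have "{w \<in> G. length w < n} \<subseteq> (\<Union>k<n. {u \<in> sorted_words p. length u = k})"
    using sorted_words by auto
  then show ?thesis using finite_sorted_words_length by (meson finite_UN finite_lessThan finite_subset)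
qed

lemma word_prefixes_subset: "E n \<subseteq> {u \<in> sorted_words p. length u = n}"
  using sorted_words set_take_subset by (fastforce simp: word_prefixes_def sorted_words_def sorted_wrt_take)

lemma finite_word_prefixes: "finite (E n)"
  using word_prefixes_subset finite_sorted_words_length finite_subset by blast

lemma card_word_prefixes: "card (E n) \<le> (n + 1) ^ p"
  using card_mono[OF finite_sorted_words_length word_prefixes_subset] card_sorted_words_length le_trans by blast

lemma finite_concat_prefixes: "finite (T n)"
proof (rule finite_subset)
  have "set (concat ws) \<subseteq> {1..p}" if "ws \<in> lists G" for ws
    using that sorted_words by (fastforce simp: sorted_words_def)
  then show "T n \<subseteq> {u. set u \<subseteq> {1..p} \<and> length u = n}"
    unfolding concat_prefixes_def using set_take_subset by fastforce
  show "finite {u. set u \<subseteq> {1..p} \<and> length u = n}"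
    by (rule finite_lists_length_eq) simp
qed

lemma hd_concat_prefixes:
  assumes "v \<in> T n" "0 < n"
  shows "\<exists>w\<in>G. v ! 0 = hd w"
proof -
  obtain ws where ws: "ws \<in> lists G" "n \<le> length (concat ws)" and v: "v = take n (concat ws)"
    using assms by (auto simp: concat_prefixes_def)
  with \<open>0 < n\<close> obtain w ws' where "ws = w # ws'" by (cases ws) auto
  with ws v \<open>0 < n\<close> show ?thesis
    using words_nonempty by (auto simp: nth_append hd_conv_nth)
qed

text \<open>The split is by whether the first word reaches length \<open>n\<close>. A word of length
  exactly \<open>n\<close> is put into \<open>E n\<close>, so every tail in the other part is
  nonempty and a descent follows \<open>w\<close>.\<close>

lemma concat_prefixes_rec:
  assumes "0 < n"
  shows "T n = E n \<union> (\<Union>w\<in>{w \<in> G. length w < n}. (@) w ` T (n - length w))"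
proof (intro equalityI subsetI)
  fix v assume "v \<in> T n"
  then obtain ws where ws: "ws \<in> lists G" "n \<le> length (concat ws)" and v: "v = take n (concat ws)"
    by (auto simp: concat_prefixes_def)
  with assms obtain w ws' where w: "ws = w # ws'" by (cases ws) auto
  show "v \<in> E n \<union> (\<Union>w\<in>{w \<in> G. length w < n}. (@) w ` T (n - length w))"
  proof (cases "n \<le> length w")
    case True
    then show ?thesis using ws v w by (auto simp: word_prefixes_def)
  next
    case False
    then have "take (n - length w) (concat ws') \<in> T (n - length w)"
      using ws w unfolding concat_prefixes_def by auto
    then show ?thesis using ws v w False by auto
  qed
next
  fix v assume "v \<in> E n \<union> (\<Union>w\<in>{w \<in> G. length w < n}. (@) w ` T (n - length w))"
  then consider w where "w \<in> G" "n \<le> length w" "v = take n w"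
    | w ws where "w \<in> G" "length w < n" "ws \<in> lists G" "n - length w \<le> length (concat ws)"
        "v = w @ take (n - length w) (concat ws)"
    unfolding word_prefixes_def concat_prefixes_def by blast
  then show "v \<in> T n"
  proof cases
    case 1
    then show ?thesis unfolding concat_prefixes_def by (intro CollectI exI[of _ "[w]"]) auto
  next
    case 2
    then show ?thesis unfolding concat_prefixes_def by (intro CollectI exI[of _ "w # ws"]) auto
  qed
qed

text \<open>One letter beyond \<open>w\<close> is the head of another word of \<open>G\<close>,
  hence smaller than the last letter of \<open>w\<close>.\<close>

lemma not_sorted_append_concat_prefix:
  assumes "w \<in> G" "v \<in> T n" "0 < n"
  shows "\<not> sorted (take (Suc (length w)) (w @ v))"
proof
  assume s: "sorted (take (Suc (length w)) (w @ v))"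
  obtain w' where w': "w' \<in> G" "v ! 0 = hd w'" using hd_concat_prefixes assms by blast
  have "v \<noteq> []" using length_concat_prefixes assms by fastforce
  then have "take (Suc (length w)) (w @ v) = w @ [hd w']" using w' by (cases v) auto
  then have "last w \<le> hd w'" using s words_nonempty[OF \<open>w \<in> G\<close>] by (auto simp: sorted_append)
  then show False using descent[of w w'] assms w' by simp
qed

text \<open>The union in \<open>concat_prefixes_rec\<close> is disjoint: if two parsings agreed, the
  shorter first word together with the next letter would be an initial part of a sorted word,
  although it ends in a descent.\<close>

lemma card_concat_prefixes_rec:
  assumes "0 < n"
  shows "card (T n) = card (E n) + (\<Sum>w | w \<in> G \<and> length w < n. card (T (n - length w)))"
proof -
  let ?U = "\<lambda>w. (@) w ` T (n - length w)"
  have sorted_take: "sorted (take k w)" if "w \<in> G" for w k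
    using that sorted_words by (auto simp: sorted_words_def sorted_wrt_take)
  have disj1: "E n \<inter> (\<Union>w\<in>{w \<in> G. length w < n}. ?U w) = {}"
  proof (rule ccontr)
    assume "\<not> ?thesis"
    then obtain w w' v where *: "w \<in> G" "w' \<in> G" "length w' < n" "v \<in> T (n - length w')" "take n w = w' @ v"
      by (auto simp: word_prefixes_def)
    have "take (Suc (length w')) (w' @ v) = take (Suc (length w')) w"
      using * by (metis Suc_leI min.absorb1 take_take)
    then show False
      using not_sorted_append_concat_prefix[of w' v "n - length w'"] sorted_take[of w "Suc (length w')"] * by simp
  qed
  have disj_less: False if "w \<in> G" "w' \<in> G" "length w < length w'"
    "v \<in> T (n - length w)" "w @ v = w' @ v'" "length w < n" for w w' v v'
  proof -
    have "take (Suc (length w)) (w @ v) = take (Suc (length w)) w'"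
      using that by simp
    then show False
      using not_sorted_append_concat_prefix[of w v "n - length w"] sorted_take[of w' "Suc (length w)"] that by simp
  qed
  have disj2: "?U w \<inter> ?U w' = {}"
    if "w \<in> {w \<in> G. length w < n}" "w' \<in> {w \<in> G. length w < n}" "w \<noteq> w'" for w w'
  proof (rule ccontr)
    assume "\<not> ?thesis"
    then obtain v v' where *: "v \<in> T (n - length w)" "v' \<in> T (n - length w')" "w @ v = w' @ v'" by auto
    show False
      using disj_less[of w w' v v'] disj_less[of w' w v' v] that *
      by (metis (no_types, lifting) append_eq_append_conv linorder_neqE_nat mem_Collect_eq)
  qed
  have "card (T n) = card (E n) + card (\<Union>w\<in>{w \<in> G. length w < n}. ?U w)"
    unfolding concat_prefixes_rec[OF assms]
    by (intro card_Un_disjoint disj1 finite_word_prefixes finite_UN_I finite_short finite_imageI finite_concat_prefixes)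
  also have "card (\<Union>w\<in>{w \<in> G. length w < n}. ?U w) = (\<Sum>w | w \<in> G \<and> length w < n. card (?U w))"
    by (intro card_UN_disjoint finite_short) (use disj2 finite_concat_prefixes in auto)
  also have "\<dots> = (\<Sum>w | w \<in> G \<and> length w < n. card (T (n - length w)))"
    by (intro sum.cong refl card_image) (auto simp: inj_on_def)
  finally show ?thesis .
qed

lemma concat_prefixes_nonempty: "T n \<noteq> {}"
proof -
  obtain w where w: "w \<in> G" using nonempty by blast
  have "n \<le> length (concat (replicate n w))"
    using length_pos[OF w] by (simp add: length_concat sum_list_replicate Suc_le_eq)
  then have "take n (concat (replicate n w)) \<in> T n"
    unfolding concat_prefixes_def using w by auto
  then show ?thesis by blast
qed

section \<open>Blocks compared with prefixes\<close>

lemma concat_prefixes_subset_blocks: "T n \<subseteq> blocks (biinfinite_concatenations G) n"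
proof
  fix v assume "v \<in> T n"
  then obtain ws where ws: "ws \<in> lists G" "n \<le> length (concat ws)" and v: "v = take n (concat ws)"
    by (auto simp: concat_prefixes_def)
  obtain g where g: "g \<in> G" using nonempty by blast
  \<comment> \<open>The given words occupy the indices from 0 on; a fixed word \<open>g\<close>
    fills both sides.\<close>
  define w where "w i = (if 0 \<le> i \<and> nat i < length ws then ws ! nat i else g)" for i :: int
  have wG: "w i \<in> G" for i using ws g by (auto simp: w_def)
  obtain x :: "int \<Rightarrow> nat" and c where c: "\<And>i. c (i + 1) = c i + int (length (w i))"
    and x: "\<And>i j. j < length (w i) \<Longrightarrow> x (c i + int j) = w i ! j"
    using ex_biinfinite_concatenation[of w] wG words_nonempty by blast
  have "x \<in> biinfinite_concatenations G"
    unfolding biinfinite_concatenations_def using wG c x by blast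
  moreover have "map (\<lambda>j. w (0 + int j)) [0..<length ws] = ws"
    by (intro nth_equalityI) (auto simp: w_def)
  then have "concat ws = map (\<lambda>j. x (c 0 + int j)) [0..<length (concat ws)]"
    using concat_eq_window[of c w x 0 "length ws"] c x by simp
  then have "v = take n (map (\<lambda>j. x (c 0 + int j)) [0..<length (concat ws)])"
    unfolding v by (rule arg_cong)
  then have "v = map (\<lambda>j. x (c 0 + int j)) [0..<n]"
    using ws by (simp add: take_map)
  ultimately show "v \<in> blocks (biinfinite_concatenations G) n"
    by (auto simp: blocks_def)
qed

text \<open>A block starts inside some word; the rest of that word is sorted, and what follows is a
  prefix of a concatenation.\<close>

lemma blocks_subset:
  "blocks (biinfinite_concatenations G) n
    \<subseteq> (\<Union>k\<le>n. \<Union>s\<in>{u \<in> sorted_words p. length u = k}. (@) s ` T (n - k))"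
proof
  fix v assume "v \<in> blocks (biinfinite_concatenations G) n"
  then obtain x k where "x \<in> biinfinite_concatenations G"
    and v: "v = map (\<lambda>j. x (k + int j)) [0..<n]"
    unfolding blocks_def by blast
  then obtain w and c :: "int \<Rightarrow> int" where wG: "\<And>i. w i \<in> G"
    and c: "\<And>i. c (i + 1) = c i + int (length (w i))"
    and x: "\<And>i j. j < length (w i) \<Longrightarrow> x (c i + int j) = w i ! j"
    unfolding biinfinite_concatenations_def by blast
  have "\<exists>!i. c i \<le> k \<and> k < c (i + 1)"
    using length_pos[OF wG] by (intro ex_unique_block_index) (simp add: c)
  then obtain i where i: "c i \<le> k" "k < c (i + 1)" by blast
  define d where "d = nat (k - c i)"
  have d: "k = c i + int d" "d < length (w i)" using i c[of i] by (auto simp: d_def)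
  \<comment> \<open>The \<open>n\<close> words after \<open>w i\<close> suffice, as each contributes
    at least one letter.\<close>
  define ws where "ws = map (\<lambda>j. w (i + int j)) [1..<Suc n]"
  define s where "s = drop d (w i)"
  have wsG: "ws \<in> lists G" using wG by (auto simp: ws_def)
  have len: "n \<le> length (concat ws)"
  proof -
    have "(\<Sum>u\<leftarrow>ws. 1) \<le> (\<Sum>u\<leftarrow>ws. length u)"
      using wsG length_pos by (intro sum_list_mono) (auto simp: Suc_le_eq)
    then show ?thesis by (simp add: length_concat ws_def sum_list_triv del: upt_Suc)
  qed
  let ?u = "concat (map (\<lambda>j. w (i + int j)) [0..<Suc n])"
  have u: "?u = w i @ concat ws"
    by (simp add: ws_def upt_conv_Cons del: upt_Suc)
  have "?u = map (\<lambda>j. x (c i + int j)) [0..<length ?u]"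
    using concat_eq_window[of c w x i "Suc n"] c x by blast
  then have "w i @ concat ws = map (\<lambda>j. x (c i + int j)) [0..<length (w i @ concat ws)]"
    unfolding u .
  then have "take n (drop d (w i @ concat ws)) =
      take n (drop d (map (\<lambda>j. x (c i + int j)) [0..<length (w i @ concat ws)]))" by simp
  also have "\<dots> = v"
    using d len by (intro nth_equalityI) (auto simp: v add.assoc)
  finally have v_eq: "v = take n (s @ concat ws)"
    using d by (simp add: s_def)
  \<comment> \<open>If \<open>s\<close> has length at least \<open>n\<close>, it is cut to
    \<open>n\<close> letters and the remaining prefix is the empty word in
    \<open>T 0\<close>.\<close>
  have sW: "take n s \<in> sorted_words p"
    using wG[of i] sorted_words set_take_subset[of n s] set_drop_subset[of d "w i"]
    by (auto simp: sorted_words_def s_def sorted_wrt_take sorted_wrt_drop)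
  have "take (n - length s) (concat ws) \<in> T (n - length s)"
    using wsG len unfolding concat_prefixes_def by auto
  moreover have "v = take n s @ take (n - length s) (concat ws)" by (simp add: v_eq)
  moreover have "n - length s = n - length (take n s)" by auto
  ultimately show "v \<in> (\<Union>k\<le>n. \<Union>s\<in>{u \<in> sorted_words p. length u = k}. (@) s ` T (n - k))"
    using sW by (intro UN_I[of "length (take n s)"] UN_I[of "take n s"]) auto
qed

section \<open>Growth bounds from a root of the weight equation\<close>

context
  fixes l :: real
  assumes l_pos: "0 < l" and l_sum: "((\<lambda>w. l ^ length w) has_sum 1) G"
begin

text \<open>Otherwise a single word would already weigh more than 1.\<close>

lemma l_le_1: "l \<le> 1"
proof (rule ccontr)
  assume "\<not> l \<le> 1"
  obtain w where w: "w \<in> G" using nonempty by blast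
  have "(\<Sum>w\<in>{w}. l ^ length w) \<le> 1"
    using l_pos w by (intro finite_sum_le_has_sum[OF l_sum]) auto
  moreover have "1 < l ^ length w"
    using \<open>\<not> l \<le> 1\<close> length_pos[OF w] by (intro one_less_power) auto
  ultimately show False by simp
qed

text \<open>After scaling by \<open>l ^ n\<close>, the coefficients \<open>l ^ length w\<close> have
  total at most 1, so the sum behaves like an average of earlier values.\<close>

lemma weighted_card_rec:
  assumes "0 < n"
  shows "real (card (T n)) * l ^ n = real (card (E n)) * l ^ n
    + (\<Sum>w | w \<in> G \<and> length w < n. l ^ length w * (real (card (T (n - length w))) * l ^ (n - length w)))"
proof -
  have "l ^ length w * (a * l ^ (n - length w)) = a * l ^ n" if "length w < n" for w :: "nat list" and a
    using that by (simp add: power_add[symmetric])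
  then have "(\<Sum>w | w \<in> G \<and> length w < n. l ^ length w * (real (card (T (n - length w))) * l ^ (n - length w)))
      = (\<Sum>w | w \<in> G \<and> length w < n. real (card (T (n - length w))) * l ^ n)"
    by (intro sum.cong) auto
  then show ?thesis
    by (simp add: card_concat_prefixes_rec[OF assms] distrib_right sum_distrib_right)
qed

lemma card_concat_prefixes_le: "real (card (T n)) * l ^ n \<le> real ((n + 1) ^ (p + 1))"
proof (induction n rule: less_induct)
  case (less n)
  show ?case
  proof (cases "n = 0")
    case False
    have "real (card (E n)) * l ^ n \<le> real ((n + 1) ^ p) * 1"
      using card_word_prefixes l_pos l_le_1
      by (intro mult_mono of_nat_mono power_le_one) auto
    moreover have "(\<Sum>w | w \<in> G \<and> length w < n. l ^ length w * (real (card (T (n - length w))) * l ^ (n - length w)))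
        \<le> (\<Sum>w | w \<in> G \<and> length w < n. l ^ length w * real (n * (n + 1) ^ p))"
    proof (intro sum_mono mult_left_mono)
      fix w assume "w \<in> {w \<in> G. length w < n}"
      then have w: "n - length w < n" using length_pos[of w] by auto
      \<comment> \<open>Words are nonempty, so the left base is at most \<open>n\<close>. Sharpening
        one factor from \<open>n + 1\<close> to \<open>n\<close> leaves room for the
        \<open>(n + 1) ^ p\<close> coming from \<open>E n\<close>.\<close>
      have "(n - length w + 1) ^ (p + 1) \<le> n * (n + 1) ^ p"
        unfolding power_add power_one_right using w by (subst mult.commute, intro mult_mono power_mono) auto
      then have "real ((n - length w + 1) ^ (p + 1)) \<le> real (n * (n + 1) ^ p)" by (rule of_nat_mono)
      with less[OF w] show "real (card (T (n - length w))) * l ^ (n - length w) \<le> real (n * (n + 1) ^ p)"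
        by linarith
    qed (use l_pos in auto)
    moreover have "(\<Sum>w | w \<in> G \<and> length w < n. l ^ length w * real (n * (n + 1) ^ p)) \<le> 1 * real (n * (n + 1) ^ p)"
      unfolding sum_distrib_right[symmetric]
      using l_pos by (intro mult_right_mono finite_sum_le_has_sum[OF l_sum] finite_short) auto
    ultimately show ?thesis
      using False by (subst weighted_card_rec) (auto simp: algebra_simps)
  qed auto
qed

text \<open>The exponent collects \<open>n + 1\<close> values of \<open>k\<close>, at most
  \<open>(n + 1) ^ p\<close> sorted words for each, and the factor \<open>(n + 1) ^ (p + 1)\<close>
  from the bound on \<open>T\<close>.\<close>

lemma card_blocks_le:
  "real (card (blocks (biinfinite_concatenations G) n)) \<le> real ((n + 1) ^ (2 * p + 2)) * (1 / l) ^ n"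
proof -
  let ?W = "\<lambda>k. {u \<in> sorted_words p. length u = k}"
  have T: "real (card (T (n - k))) \<le> real ((n + 1) ^ (p + 1)) * (1 / l) ^ n" for k
  proof -
    have "real (card (T (n - k))) \<le> real ((n - k + 1) ^ (p + 1)) * (1 / l) ^ (n - k)"
      using card_concat_prefixes_le[of "n - k"] l_pos by (simp add: field_simps power_divide)
    also have "\<dots> \<le> real ((n + 1) ^ (p + 1)) * (1 / l) ^ n"
      using l_pos l_le_1
      by (intro mult_mono of_nat_mono power_mono power_increasing) (auto simp: field_simps)
    finally show ?thesis .
  qed
  have "card (blocks (biinfinite_concatenations G) n) \<le> card (\<Union>k\<le>n. \<Union>s\<in>?W k. (@) s ` T (n - k))"
    by (intro card_mono blocks_subset finite_UN_I finite_atMost finite_sorted_words_length finite_imageI finite_concat_prefixes)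
  also have "\<dots> \<le> (\<Sum>k\<le>n. card (\<Union>s\<in>?W k. (@) s ` T (n - k)))"
    by (rule card_UN_le) simp
  also have "\<dots> \<le> (\<Sum>k\<le>n. \<Sum>s\<in>?W k. card ((@) s ` T (n - k)))"
    by (intro sum_mono card_UN_le finite_sorted_words_length)
  also have "\<dots> \<le> (\<Sum>k\<le>n. \<Sum>s\<in>?W k. card (T (n - k)))"
    by (intro sum_mono card_image_le finite_concat_prefixes)
  also have "\<dots> = (\<Sum>k\<le>n. card (?W k) * card (T (n - k)))"
    by simp
  also have "\<dots> \<le> (\<Sum>k\<le>n. (n + 1) ^ p * card (T (n - k)))"
  proof (intro sum_mono mult_right_mono)
    fix k assume "k \<in> {..n}"
    then show "card (?W k) \<le> (n + 1) ^ p"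
      using card_sorted_words_length[of p k] power_mono[of "k + 1" "n + 1" p] by simp
  qed simp
  finally have "real (card (blocks (biinfinite_concatenations G) n))
      \<le> real (\<Sum>k\<le>n. (n + 1) ^ p * card (T (n - k)))" by (rule of_nat_mono)
  also have "\<dots> = (\<Sum>k\<le>n. real ((n + 1) ^ p) * real (card (T (n - k))))" by simp
  also have "\<dots> \<le> (\<Sum>k\<le>n. real ((n + 1) ^ p) * (real ((n + 1) ^ (p + 1)) * (1 / l) ^ n))"
    by (intro sum_mono mult_left_mono T) auto
  also have "\<dots> = real ((n + 1) ^ (2 * p + 2)) * (1 / l) ^ n"
  proof -
    have "2 * p + 2 = Suc (p + (p + 1))" by simp
    then show ?thesis by (simp only: power_Suc power_add sum_constant card_atMost of_nat_mult Suc_eq_plus1 power_one_right mult_ac)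
  qed
  finally show ?thesis .
qed

text \<open>Words sharing their first \<open>n\<close> letters differ in their remainders, which are
  distinct sorted words. Each prefix in \<open>E n\<close> therefore carries at most
  \<open>l ^ n\<close> times the total weight of sorted words.\<close>

lemma sum_long_words_le:
  assumes F: "finite F" "F \<subseteq> {w \<in> G. n \<le> length w}" and l: "l < 1"
  shows "(\<Sum>w\<in>F. l ^ length w) \<le> real (card (E n)) * l ^ n * infsum (\<lambda>u. l ^ length u) (sorted_words p)"
proof -
  let ?K = "infsum (\<lambda>u. l ^ length u) (sorted_words p)"
  have K: "0 \<le> ?K" using l_pos by (intro infsum_nonneg) auto
  have "(\<Sum>w\<in>F. l ^ length w) = (\<Sum>t\<in>take n ` F. \<Sum>w\<in>{w \<in> F. take n w = t}. l ^ length w)"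
    by (rule sum.image_gen[OF F(1)])
  also have "\<dots> \<le> (\<Sum>t\<in>take n ` F. l ^ n * ?K)"
  proof (rule sum_mono)
    fix t
    let ?D = "{w \<in> F. take n w = t}"
    have "(\<Sum>w\<in>?D. l ^ length w) = (\<Sum>w\<in>?D. l ^ n * l ^ length (drop n w))"
      using F(2) by (intro sum.cong) (auto simp: power_add[symmetric])
    also have "\<dots> = l ^ n * (\<Sum>u\<in>drop n ` ?D. l ^ length u)"
      by (subst sum.reindex) (auto simp: inj_on_def sum_distrib_left, metis append_take_drop_id)
    also have "\<dots> \<le> l ^ n * ?K"
    proof (intro mult_left_mono finite_sum_le_infsum summable_on_sorted_words)
      show "drop n ` ?D \<subseteq> sorted_words p"
        using F(2) sorted_words by (auto simp: sorted_words_def sorted_wrt_drop dest!: in_set_dropD)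
    qed (use F l_pos l in auto)
    finally show "(\<Sum>w\<in>?D. l ^ length w) \<le> l ^ n * ?K" .
  qed
  also have "\<dots> = real (card (take n ` F)) * (l ^ n * ?K)" by simp
  also have "\<dots> \<le> real (card (E n)) * (l ^ n * ?K)"
    using F l_pos K
    by (intro mult_right_mono of_nat_mono card_mono finite_word_prefixes) (auto simp: word_prefixes_def)
  finally show ?thesis by (simp add: mult.assoc)
qed

lemma card_concat_prefixes_ge:
  obtains C where "0 < C" "\<And>n. C \<le> real (card (T n)) * l ^ n"
proof (cases "l < 1")
  \<comment> \<open>At \<open>l = 1\<close> the series over sorted words diverges, but then
    nonemptiness of \<open>T n\<close> is already the bound.\<close>
  case False
  then have "l = 1" using l_le_1 by simp
  moreover have "1 \<le> real (card (T n))" for n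
    using concat_prefixes_nonempty finite_concat_prefixes by (simp add: Suc_le_eq card_gt_0_iff)
  ultimately show thesis using that[of 1] by simp
next
  case True
  define K where "K = infsum (\<lambda>u. l ^ length u) (sorted_words p)"
  have "(\<Sum>u\<in>{[] :: nat list}. l ^ length u) \<le> K" unfolding K_def
    using True l_pos by (intro finite_sum_le_infsum summable_on_sorted_words) (auto simp: sorted_words_def)
  then have K: "1 \<le> K" by simp
  \<comment> \<open>The total weight 1 splits into short words and long words, the latter controlled
    by \<open>E n\<close>.\<close>
  have mass: "1 \<le> (\<Sum>w | w \<in> G \<and> length w < n. l ^ length w) + real (card (E n)) * l ^ n * K" for n
  proof (rule has_sum_le_finite_sums[OF l_sum])
    fix F assume F: "finite F" "F \<subseteq> G"
    have "(\<Sum>w\<in>F. l ^ length w) =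
        (\<Sum>w\<in>{w \<in> F. length w < n}. l ^ length w) + (\<Sum>w\<in>{w \<in> F. n \<le> length w}. l ^ length w)"
      using F by (subst sum.union_disjoint[symmetric]) (auto intro!: sum.cong)
    also have "\<dots> \<le> (\<Sum>w | w \<in> G \<and> length w < n. l ^ length w) + real (card (E n)) * l ^ n * K"
      unfolding K_def
      by (intro add_mono sum_mono2 sum_long_words_le finite_short) (use F l_pos True in auto)
    finally show "(\<Sum>w\<in>F. l ^ length w) \<le> \<dots>" .
  qed
  have "1 / K \<le> real (card (T n)) * l ^ n" for n
  proof (induction n rule: less_induct)
    case (less n)
    show ?case
    proof (cases "n = 0")
      case True
      then show ?thesis using K by simp
    next
      case False
      \<comment> \<open>In the product with \<open>1 / K\<close> the factor \<open>K\<close> cancels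
        in the \<open>E n\<close> term, and each short word gets the coefficient
        \<open>1 / K\<close>, to which the induction hypothesis applies.\<close>
      have "1 / K \<le> 1 / K * ((\<Sum>w | w \<in> G \<and> length w < n. l ^ length w) + real (card (E n)) * l ^ n * K)"
        using mass[of n] K by (simp add: field_simps)
      also have "\<dots> = real (card (E n)) * l ^ n + (\<Sum>w | w \<in> G \<and> length w < n. l ^ length w * (1 / K))"
        using K by (simp add: distrib_left sum_divide_distrib)
      also have "\<dots> \<le> real (card (E n)) * l ^ n
          + (\<Sum>w | w \<in> G \<and> length w < n. l ^ length w * (real (card (T (n - length w))) * l ^ (n - length w)))"
        using l_pos length_pos by (intro add_left_mono sum_mono mult_left_mono less) auto
      also have "\<dots> = real (card (T n)) * l ^ n"
        using False by (simp add: weighted_card_rec)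
      finally show ?thesis .
    qed
  qed
  then show thesis using that[of "1 / K"] K by simp
qed

text \<open>Constant and polynomial factors vanish after taking logarithms and dividing by
  \<open>n\<close>, so both bounds squeeze to the same limit.\<close>

lemma block_growth_tendsto:
  "block_growth (biinfinite_concatenations G) \<longlonglongrightarrow> ln (1 / l)"
proof -
  let ?B = "\<lambda>n. real (card (blocks (biinfinite_concatenations G) n))"
  obtain C where C: "0 < C" "\<And>n. C \<le> real (card (T n)) * l ^ n"
    using card_concat_prefixes_ge by blast
  have fin: "finite (blocks (biinfinite_concatenations G) n)" for n
    by (rule finite_subset[OF blocks_subset])
      (intro finite_UN_I finite_atMost finite_sorted_words_length finite_imageI finite_concat_prefixes)
  have lower: "C * (1 / l) ^ n \<le> ?B n" for n
  proof -
    have "C * (1 / l) ^ n \<le> real (card (T n))"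
      using C(2)[of n] l_pos by (simp add: field_simps power_divide)
    also have "\<dots> \<le> ?B n"
      by (intro of_nat_mono card_mono fin concat_prefixes_subset_blocks)
    finally show ?thesis .
  qed
  have pos: "0 < C * (1 / l) ^ n" for n using C l_pos by simp
  show ?thesis
  proof (rule real_tendsto_sandwich)
    show "\<forall>\<^sub>F n in sequentially. ln C / real n + ln (1 / l) \<le> block_growth (biinfinite_concatenations G) n"
      using eventually_gt_at_top[of 0]
    proof eventually_elim
      case (elim n)
      have "ln C + real n * ln (1 / l) = ln (C * (1 / l) ^ n)"
        using C l_pos by (simp add: ln_mult ln_realpow)
      also have "\<dots> \<le> ln (?B n)"
        using lower[of n] pos[of n] by (intro ln_mono) auto
      finally show ?case
        using elim divide_right_mono[of _ "ln (?B n)" "real n"] by (fastforce simp: block_growth_def add_divide_distrib)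
    qed
    show "\<forall>\<^sub>F n in sequentially. block_growth (biinfinite_concatenations G) n
        \<le> real (2 * p + 2) * ln (real n + 1) / real n + ln (1 / l)"
      using eventually_gt_at_top[of 0]
    proof eventually_elim
      case (elim n)
      have "ln (?B n) \<le> ln (real ((n + 1) ^ (2 * p + 2)) * (1 / l) ^ n)"
        using lower[of n] pos[of n] card_blocks_le[of n] by (intro ln_mono) auto
      also have "\<dots> = ln ((real n + 1) ^ (2 * p + 2)) + ln ((1 / l) ^ n)"
        unfolding of_nat_power of_nat_add of_nat_1 using l_pos by (intro ln_mult_pos) auto
      also have "\<dots> = real (2 * p + 2) * ln (real n + 1) + real n * ln (1 / l)"
        using l_pos by (subst (1 2) ln_realpow) auto
      finally show ?case
        using elim divide_right_mono[of "ln (?B n)" _ "real n"] by (fastforce simp: block_growth_def add_divide_distrib)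
    qed
    show "(\<lambda>n. ln C / real n + ln (1 / l)) \<longlonglongrightarrow> ln (1 / l)" by real_asymp
    show "(\<lambda>n. real (2 * p + 2) * ln (real n + 1) / real n + ln (1 / l)) \<longlonglongrightarrow> ln (1 / l)" by real_asymp
  qed
qed

end

section \<open>Existence and uniqueness of the root\<close>

text \<open>A single word forces \<open>l = 1\<close>. Two distinct words already weigh more than 1
  together just below 1, where the series still converges, so the intermediate value theorem gives a
  root.\<close>

lemma ex_has_sum_1: "\<exists>l::real. 0 < l \<and> ((\<lambda>w. l ^ length w) has_sum 1) G"
proof (cases "\<exists>w. G = {w}")
  case True
  then obtain w where "G = {w}" by blast
  then show ?thesis
    using has_sum_finite[of "{w}" "\<lambda>w. (1::real) ^ length w"] by (intro exI[of _ 1]) auto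
next
  case False
  then obtain u v where uv: "u \<in> G" "v \<in> G" "u \<noteq> v" using nonempty by blast
  have "((\<lambda>x::real. x ^ length u + x ^ length v) \<longlongrightarrow> 1 ^ length u + 1 ^ length v) (at_left 1)"
    by (intro tendsto_intros)
  then have "\<forall>\<^sub>F x::real in at_left 1. 1 < x ^ length u + x ^ length v"
    by (rule order_tendstoD) simp
  moreover have "\<forall>\<^sub>F x::real in at_left 1. 0 < x \<and> x < 1"
    using eventually_at_left_real[of 0 1] by simp
  ultimately have "\<exists>x::real. 1 < x ^ length u + x ^ length v \<and> 0 < x \<and> x < 1"
    by (metis (mono_tags, lifting) eventually_conj eventually_happens trivial_limit_at_left_real)
  then obtain x :: real where x: "1 < x ^ length u + x ^ length v" "0 < x" "x < 1" by blast
  define g where "g y = infsum (\<lambda>w. y ^ length w) G" for y :: real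
  have summable_x: "(\<lambda>w. x ^ length w) summable_on G"
    using summable_on_sorted_words[OF x(2,3)] sorted_words summable_on_subset_banach by blast
  \<comment> \<open>Terms on \<open>{0..x}\<close> are dominated by their values at
    \<open>x\<close>, so the finite partial sums, which are polynomials, converge uniformly and
    \<open>g\<close> is continuous.\<close>
  have "uniform_limit {0..x} (\<lambda>F y. \<Sum>w\<in>F. y ^ length w) g (finite_subsets_at_top G)"
    unfolding g_def
    by (rule Weierstrass_m_test_general[OF _ summable_x]) (auto simp: power_abs intro!: power_mono)
  then have "continuous_on {0..x} g"
    by (rule uniform_limit_theorem[rotated]) (auto intro!: always_eventually continuous_intros)
  \<comment> \<open>An empty word would contribute \<open>0 ^ 0 = 1\<close> here.\<close>
  moreover have "g 0 = 0"
    unfolding g_def by (intro infsum_0) (use words_nonempty in auto)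
  moreover have "1 \<le> g x"
  proof -
    have "(\<Sum>w\<in>{u, v}. x ^ length w) \<le> g x"
      unfolding g_def using uv x by (intro finite_sum_le_infsum summable_x) auto
    then show ?thesis using x uv by simp
  qed
  ultimately obtain l where l: "0 \<le> l" "l \<le> x" "g l = 1"
    using IVT'[of g 0 1 x] x by auto
  then have "0 < l" using \<open>g 0 = 0\<close> by (cases "l = 0") auto
  have "(\<lambda>w. l ^ length w) summable_on G"
    using l by (intro summable_on_comparison_test[OF summable_x] power_mono) auto
  then show ?thesis
    using l \<open>0 < l\<close> has_sum_infsum unfolding g_def by metis
qed

text \<open>Every term increases strictly with the base, since words are nonempty.\<close>

lemma has_sum_1_unique:
  fixes a b :: real
  assumes "0 < a" "0 < b"
    and "((\<lambda>w. a ^ length w) has_sum 1) G" "((\<lambda>w. b ^ length w) has_sum 1) G"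
  shows "a = b"
proof -
  have less: False if "0 < a" "a < b" and a: "((\<lambda>w. a ^ length w) has_sum 1) G"
    and b: "((\<lambda>w. b ^ length w) has_sum 1) G" for a b :: real
  proof -
    obtain w where w: "w \<in> G" using nonempty by blast
    have "(1::real) < 1"
      using that w length_pos by (intro has_sum_strict_mono[OF a b _ w]) (auto intro!: power_mono power_strict_mono)
    then show False by simp
  qed
  show ?thesis using less assms by (metis linorder_less_linear)
qed

end

section \<open>The core set and its entropy\<close>

text \<open>Positive multiplicities make every core word start with 1 and end with \<open>p\<close>,
  and \<open>p \<ge> 2\<close> makes each boundary a descent.\<close>

lemma core_set_descent_code:
  assumes "p \<ge> 2"
    and ne: "\<And>i. i \<in> {1..p} \<Longrightarrow> S i \<noteq> {}"
    and pos: "\<And>i. i \<in> {1..p} \<Longrightarrow> S i \<subseteq> {1..}"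
  shows "descent_code p (core_set p S)"
proof -
  have sorted: "sorted (concat (map (\<lambda>i. replicate (m i) i) [1..<n]))" for m n
    by (induction n) (auto simp: sorted_append)
  have ends: "w \<noteq> [] \<and> hd w = 1 \<and> last w = p" if mem: "w \<in> core_set p S" for w
  proof -
    obtain m where m: "\<forall>i\<in>{1..p}. m i \<in> S i"
      and w: "w = concat (map (\<lambda>i. replicate (m i) i) [1..<Suc p])"
      using mem unfolding core_set_def by blast
    have "m 1 > 0" "m p > 0" using bspec[OF m, of 1] bspec[OF m, of p] pos[of 1] pos[of p] \<open>p \<ge> 2\<close> by auto
    moreover have "[1..<Suc p] = 1 # [2..<Suc p]"
      using \<open>p \<ge> 2\<close> by (simp add: upt_conv_Cons numeral_2_eq_2 del: upt_Suc)
    then have "w = replicate (m 1) 1 @ concat (map (\<lambda>i. replicate (m i) i) [2..<Suc p])"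
      by (simp add: w del: upt_Suc)
    moreover have "w = concat (map (\<lambda>i. replicate (m i) i) [1..<p]) @ replicate (m p) p"
      using \<open>p \<ge> 2\<close> by (simp add: w)
    ultimately show ?thesis
      by (metis append_is_Nil_conv hd_append2 hd_replicate last_appendR last_replicate
          less_numeral_extra(3) replicate_empty)
  qed
  show ?thesis
  proof
    show "core_set p S \<subseteq> sorted_words p"
      using sorted[of _ "Suc p"] by (auto simp: core_set_def sorted_words_def simp del: upt_Suc)
    have "\<forall>i\<in>{1..p}. (SOME s. s \<in> S i) \<in> S i" using ne by (simp add: some_in_eq)
    then have "concat (map (\<lambda>i. replicate (SOME s. s \<in> S i) i) [1..<Suc p]) \<in> core_set p S"
      unfolding core_set_def by (intro CollectI exI[of _ "\<lambda>i. SOME s. s \<in> S i"] conjI refl)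
    then show "core_set p S \<noteq> {}" by blast
  qed (use ends \<open>p \<ge> 2\<close> in auto)
qed

theorem theorem4p1:
  fixes p :: nat and S :: "nat \<Rightarrow> nat set"
  assumes "p \<ge> 2"
    and "\<And>i. i \<in> {1..p} \<Longrightarrow> S i \<noteq> {}"
    and "\<And>i. i \<in> {1..p} \<Longrightarrow> S i \<subseteq> {1..}"
  shows "(\<exists>!l::real. l > 0 \<and> ((\<lambda>\<omega>. l ^ length \<omega>) has_sum 1) (core_set p S)) \<and>
    (\<forall>l::real. l > 0 \<and> ((\<lambda>\<omega>. l ^ length \<omega>) has_sum 1) (core_set p S) \<longrightarrow>
       convergent (block_growth (limited_shift p S)) \<and>
       topological_entropy (limited_shift p S) = ln (1 / l))"
proof -
  interpret descent_code p "core_set p S"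
    using assms by (rule core_set_descent_code)
  have "block_growth (limited_shift p S) = block_growth (biinfinite_concatenations (core_set p S))"
    by (simp add: fun_eq_iff block_growth_def limited_shift_def blocks_closure)
  then have lim: "block_growth (limited_shift p S) \<longlonglongrightarrow> ln (1 / l)"
    if "l > 0" "((\<lambda>\<omega>. l ^ length \<omega>) has_sum 1) (core_set p S)" for l
    using block_growth_tendsto[OF that] by simp
  show ?thesis
    using ex_has_sum_1 has_sum_1_unique lim
    unfolding topological_entropy_def by (blast intro: convergentI limI)
qed

end
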